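(* Let $G=(V,E)$ be a DAG with maximum out-degree $d_{out}$ and topological depth $\ell$. Then for every visit rule $r$ of $G$ there exists an $r$-visit $\psi$ of $G$ such that $b_r(\psi)\leq (d_{out}-1)\ell+1$.
   Context: For a vertex $v$ of a finite DAG $G=(V,E)$, $\mathrm{pred}(v)=\{u : (u,v)\in E\}$ and $\mathrm{suc}(v)=\{u : (v,u)\in E\}$; the maximum out-degree is $\max_v|\mathrm{suc}(v)|$. The topological depth of $G$ is the number of edges of a longest directed path in $G$. A visit rule $r$ for $G$ assigns to each $v\in V$ a non-empty family $r(v)$ of subsets of $\mathrm{pred}(v)$, called enablers of $v$. An $r$-sequence is a sequence $\psi$ of distinct vertices such that for every $1\le i\le|\psi|$ the set of vertices of the prefix $\psi[1..i-1]$ contains some enabler $Q\in r(\psi[i])$. An $r$-visit is an $r$-sequence containing all $|V|$ vertices. The $r$-boundary of an $r$-sequence $\psi$ is $B_r(\psi)=\{v\in V\setminus\psi : \exists Q\neq\emptyset,\ Q\in r(v),\ Q\subseteq\psi\}$, and $b_r(\psi)=\max_{1\le i\le|\psi|}|B_r(\psi[1..i])|$. *)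

theory Defs
  imports Main
begin

text \<open>A finite DAG is a finite vertex set with an acyclic set of edges between its vertices.
  All maxima below are maxima of natural numbers and include the value 0. This only matters
  for a maximum over the empty set, i.e. for the graph without vertices; in every other case
  it does not change the value.\<close>

definition finite_dag :: "'v set \<Rightarrow> ('v \<times> 'v) set \<Rightarrow> bool" where
  "finite_dag V E \<longleftrightarrow> finite V \<and> E \<subseteq> V \<times> V \<and> acyclic E"

definition preds :: "('v \<times> 'v) set \<Rightarrow> 'v \<Rightarrow> 'v set" where
  "preds E v = {u. (u, v) \<in> E}"

definition sucs :: "('v \<times> 'v) set \<Rightarrow> 'v \<Rightarrow> 'v set" where
  "sucs E v = {u. (v, u) \<in> E}"

definition max_out_degree :: "'v set \<Rightarrow> ('v \<times> 'v) set \<Rightarrow> nat" where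
  "max_out_degree V E = Max (insert 0 ((\<lambda>v. card (sucs E v)) ` V))"

definition directed_path :: "'v set \<Rightarrow> ('v \<times> 'v) set \<Rightarrow> 'v list \<Rightarrow> bool" where
  "directed_path V E p \<longleftrightarrow>
     p \<noteq> [] \<and> distinct p \<and> set p \<subseteq> V \<and> successively (\<lambda>u v. (u, v) \<in> E) p"

text \<open>A path given by its list of vertices has one edge less than it has vertices.\<close>

definition topological_depth :: "'v set \<Rightarrow> ('v \<times> 'v) set \<Rightarrow> nat" where
  "topological_depth V E = Max (insert 0 {length p - 1 | p. directed_path V E p})"

definition visit_rule :: "'v set \<Rightarrow> ('v \<times> 'v) set \<Rightarrow> ('v \<Rightarrow> 'v set set) \<Rightarrow> bool" where
  "visit_rule V E r \<longleftrightarrow> (\<forall>v\<in>V. r v \<noteq> {} \<and> (\<forall>Q\<in>r v. Q \<subseteq> preds E v))"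

text \<open>Lists are indexed from 0, so the vertices preceding position \<open>i\<close> are those of
  \<open>take i \<psi>\<close>.\<close>

definition r_sequence :: "'v set \<Rightarrow> ('v \<Rightarrow> 'v set set) \<Rightarrow> 'v list \<Rightarrow> bool" where
  "r_sequence V r \<psi> \<longleftrightarrow>
     distinct \<psi> \<and> set \<psi> \<subseteq> V \<and> (\<forall>i<length \<psi>. \<exists>Q\<in>r (\<psi> ! i). Q \<subseteq> set (take i \<psi>))"

definition r_visit :: "'v set \<Rightarrow> ('v \<Rightarrow> 'v set set) \<Rightarrow> 'v list \<Rightarrow> bool" where
  "r_visit V r \<psi> \<longleftrightarrow> r_sequence V r \<psi> \<and> set \<psi> = V"

definition r_boundary :: "'v set \<Rightarrow> ('v \<Rightarrow> 'v set set) \<Rightarrow> 'v list \<Rightarrow> 'v set" where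
  "r_boundary V r \<psi> = {v \<in> V - set \<psi>. \<exists>Q\<in>r v. Q \<noteq> {} \<and> Q \<subseteq> set \<psi>}"

definition max_boundary :: "'v set \<Rightarrow> ('v \<Rightarrow> 'v set set) \<Rightarrow> 'v list \<Rightarrow> nat" where
  "max_boundary V r \<psi> = Max (insert 0 ((\<lambda>i. card (r_boundary V r (take i \<psi>))) ` {1..length \<psi>}))"

end

theory Submission
  imports Defs
begin

text \<open>Build the visit depth first. Throughout, the boundary is covered by the successors of the
  vertices of a visited directed path. If the boundary is non-empty, cut the path after its last
  vertex having a boundary successor \<open>v\<close>; visiting \<open>v\<close> extends the path by \<open>v\<close>, because every
  newly enabled vertex is a successor of \<open>v\<close>. If the boundary is empty, restart with any vertex
  that has the empty enabler. A cut path followed by \<open>v\<close> is a directed path, so the cut path has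
  at most \<open>\<ell>\<close> vertices; each of them except the last has a successor that is already visited, so
  it contributes at most \<open>d - 1\<close> vertices to the boundary, and the last contributes at
  most \<open>d\<close>.\<close>

lemma card_sucs_le_max_out_degree:
  assumes "finite V" and "v \<in> V"
  shows "card (sucs E v) \<le> max_out_degree V E"
  unfolding max_out_degree_def using assms by (intro Max_ge) auto

lemma finite_sucs:
  assumes "finite_dag V E"
  shows "finite (sucs E v)"
proof (rule finite_subset)
  show "sucs E v \<subseteq> V" using assms by (auto simp: sucs_def finite_dag_def)
  show "finite V" using assms by (simp add: finite_dag_def)
qed

lemma finite_directed_path_lengths:
  assumes "finite V"
  shows "finite {length p - 1 | p. directed_path V E p}"
proof (rule finite_subset)
  show "{length p - 1 | p. directed_path V E p} \<subseteq> {..card V}"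
  proof clarsimp
    fix p assume "directed_path V E p"
    then have "length p \<le> card V"
      unfolding directed_path_def using assms by (metis card_mono distinct_card)
    then show "length p - Suc 0 \<le> card V" by simp
  qed
qed simp

lemma directed_path_length_le_depth:
  assumes "finite V" and "directed_path V E p"
  shows "length p - 1 \<le> topological_depth V E"
  unfolding topological_depth_def
  using finite_directed_path_lengths[OF assms(1), of E] assms(2) by (intro Max_ge) auto

lemma topological_depth_no_edges: "topological_depth V {} = 0"
proof -
  have "length p - 1 = 0" if "directed_path V {} p" for p
    \<comment> \<open>\<open>remdups_adj.cases\<close> serves only to split lists into empty,
      singleton and longer ones; a longer path would need an edge.\<close>
    using that by (cases p rule: remdups_adj.cases) (auto simp: directed_path_def)
  then have "insert 0 {length p - 1 | p. directed_path V {} p} = {0}" by auto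
  then show ?thesis by (simp only: topological_depth_def Max_singleton)
qed

lemma max_out_degree_pos:
  assumes "finite_dag V E" and "E \<noteq> {}"
  shows "1 \<le> max_out_degree V E"
proof -
  obtain u v where uv: "(u, v) \<in> E" using assms(2) by auto
  then have "u \<in> V" using assms(1) by (auto simp: finite_dag_def)
  moreover have "1 \<le> card (sucs E u)"
    using uv finite_sucs[OF assms(1), of u]
    by (metis One_nat_def Suc_leI card_gt_0_iff empty_iff mem_Collect_eq sucs_def)
  ultimately show ?thesis
    using card_sucs_le_max_out_degree[of V u E] assms(1) by (auto simp: finite_dag_def)
qed

text \<open>Every path vertex but the last has the next one as a successor in \<open>S\<close>,
  which leaves at most \<open>d - 1\<close> others for the maximum out-degree \<open>d\<close>. The
  \<open>+ 1\<close> is spent once, on the last vertex: d \<le> (d - 1) + 1, also when d = 0 under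
  truncated subtraction.\<close>

lemma card_unvisited_sucs_of_path_le:
  assumes "finite_dag V E" and "set p \<subseteq> V" and "successively (\<lambda>u v. (u, v) \<in> E) p"
    and "set p \<subseteq> S"
  shows "card ((\<Union>u\<in>set p. sucs E u) - S) \<le> (max_out_degree V E - 1) * length p + 1"
  using assms(2-4)
proof (induction p rule: induct_list012)
  case 1
  then show ?case by simp
next
  case (2 u)
  have "card (sucs E u - S) \<le> card (sucs E u)"
    using finite_sucs[OF assms(1)] by (intro card_mono) auto
  also have "\<dots> \<le> max_out_degree V E"
    using assms(1) 2 by (intro card_sucs_le_max_out_degree) (auto simp: finite_dag_def)
  finally show ?case by simp
next
  case (3 u w q)
  let ?d = "max_out_degree V E"
  let ?A = "\<lambda>p. (\<Union>u\<in>set p. sucs E u) - S"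
  have "card (sucs E u - S) \<le> card (sucs E u - {w})"
    using finite_sucs[OF assms(1)] 3 by (intro card_mono) auto
  also have "\<dots> = card (sucs E u) - 1"
    using finite_sucs[OF assms(1)] 3 by (simp add: sucs_def)
  also have "\<dots> \<le> ?d - 1"
    using assms(1) 3 by (intro diff_le_mono card_sucs_le_max_out_degree) (auto simp: finite_dag_def)
  finally have head: "card (sucs E u - S) \<le> ?d - 1" .
  have "?A (u # w # q) = (sucs E u - S) \<union> ?A (w # q)" by auto
  then have "card (?A (u # w # q)) \<le> card (sucs E u - S) + card (?A (w # q))"
    by (metis card_Un_le)
  also have "\<dots> \<le> (?d - 1) + ((?d - 1) * length (w # q) + 1)"
    using head "3.IH"(2) "3.prems" by (intro add_mono) auto
  finally show ?case by simp
qed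

text \<open>The cut is at the last entry \<open>u\<close> with \<open>f u\<close> meeting
  \<open>B\<close>: later entries cover nothing of \<open>B\<close>, and reverse induction discards
  them one by one.\<close>

lemma cut_covering_list:
  assumes "B \<noteq> {}" and "B \<subseteq> (\<Union>u\<in>set p. f u)"
  obtains q u s where "p = q @ u # s" and "B \<subseteq> (\<Union>w\<in>set (q @ [u]). f w)" and "B \<inter> f u \<noteq> {}"
  using assms(2)
proof (induction p arbitrary: thesis rule: rev_induct)
  case Nil
  then show ?case using assms(1) by simp
next
  case (snoc x xs)
  show ?case
  proof (cases "B \<inter> f x = {}")
    case True
    then have "B \<subseteq> (\<Union>u\<in>set xs. f u)" using snoc.prems(2) by auto
    then obtain q u s where "xs = q @ u # s" "B \<subseteq> (\<Union>w\<in>set (q @ [u]). f w)" "B \<inter> f u \<noteq> {}"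
      using snoc.IH by blast
    then show ?thesis by (intro snoc.prems(1)[of q u "s @ [x]"]) auto
  next
    case False
    then show ?thesis using snoc.prems by blast
  qed
qed

text \<open>The invariant of the construction, with \<open>p\<close> as the current depth-first
  path. Unlike in \<open>directed_path\<close>, \<open>p\<close> may be empty, so that the invariant
  holds before the first visit.\<close>

definition covers_boundary ::
  "'v set \<Rightarrow> ('v \<times> 'v) set \<Rightarrow> ('v \<Rightarrow> 'v set set) \<Rightarrow> 'v list \<Rightarrow> 'v list \<Rightarrow> bool" where
  "covers_boundary V E r \<psi> p \<longleftrightarrow>
     set p \<subseteq> set \<psi> \<and> distinct p \<and> successively (\<lambda>u v. (u, v) \<in> E) p \<and>
     r_boundary V r \<psi> \<subseteq> (\<Union>u\<in>set p. sucs E u)"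

text \<open>Used both to bound the boundary and to choose the next vertex. Appending
  \<open>v\<close> keeps the path distinct because \<open>v\<close> is unvisited while all of
  \<open>q\<close> is visited.\<close>

lemma covers_boundary_cut:
  assumes "covers_boundary V E r \<psi> p" and "r_boundary V r \<psi> \<noteq> {}" and "set \<psi> \<subseteq> V"
  obtains q v where "covers_boundary V E r \<psi> q" and "v \<in> r_boundary V r \<psi>"
    and "directed_path V E (q @ [v])"
proof -
  from assms(1,2) obtain q u s where p: "p = q @ u # s"
    and cov: "r_boundary V r \<psi> \<subseteq> (\<Union>w\<in>set (q @ [u]). sucs E w)"
    and "r_boundary V r \<psi> \<inter> sucs E u \<noteq> {}"
    unfolding covers_boundary_def by (metis cut_covering_list)
  then obtain v where v: "v \<in> r_boundary V r \<psi>" "(u, v) \<in> E" by (auto simp: sucs_def)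
  have "covers_boundary V E r \<psi> (q @ [u])"
    using assms(1) cov unfolding covers_boundary_def p by (auto simp: successively_append_iff)
  moreover from this have "directed_path V E ((q @ [u]) @ [v])"
    using v assms(3) unfolding covers_boundary_def directed_path_def
    by (auto simp: r_boundary_def successively_append_iff)
  ultimately show thesis using v(1) that by blast
qed

lemma card_r_boundary_le:
  assumes "finite_dag V E" and "set \<psi> \<subseteq> V" and "covers_boundary V E r \<psi> p"
  shows "card (r_boundary V r \<psi>) \<le> (max_out_degree V E - 1) * topological_depth V E + 1"
proof (cases "r_boundary V r \<psi> = {}")
  case True
  then show ?thesis by simp
next
  case False
  with assms obtain q v where q: "covers_boundary V E r \<psi> q" and "directed_path V E (q @ [v])"
    using covers_boundary_cut by metis
  \<comment> \<open>With the endpoint \<open>v\<close> included, the path has exactly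
    \<open>length q\<close> edges; \<open>q\<close> alone would allow one more vertex than the
    depth.\<close>
  then have len: "length q \<le> topological_depth V E"
    using directed_path_length_le_depth[of V E "q @ [v]"] assms(1) by (simp add: finite_dag_def)
  have "r_boundary V r \<psi> \<inter> set \<psi> = {}" by (auto simp: r_boundary_def)
  then have "card (r_boundary V r \<psi>) \<le> card ((\<Union>u\<in>set q. sucs E u) - set \<psi>)"
    using q finite_sucs[OF assms(1)] by (intro card_mono) (auto simp: covers_boundary_def)
  also have "\<dots> \<le> (max_out_degree V E - 1) * length q + 1"
    using q assms(1,2) by (intro card_unvisited_sucs_of_path_le) (auto simp: covers_boundary_def)
  also have "\<dots> \<le> (max_out_degree V E - 1) * topological_depth V E + 1"
    using len by simp
  finally show ?thesis .
qed

text \<open>An enabler completed by visiting \<open>v\<close> contains \<open>v\<close>, and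
  enablers consist of predecessors.\<close>

lemma r_boundary_snoc_subset:
  assumes "visit_rule V E r"
  shows "r_boundary V r (\<psi> @ [v]) \<subseteq> r_boundary V r \<psi> \<union> sucs E v"
proof
  fix x assume "x \<in> r_boundary V r (\<psi> @ [v])"
  then obtain Q where x: "x \<in> V" "x \<notin> set \<psi>" and Q: "Q \<in> r x" "Q \<noteq> {}" "Q \<subseteq> insert v (set \<psi>)"
    by (auto simp: r_boundary_def)
  have "Q \<subseteq> preds E x" using assms x(1) Q(1) by (auto simp: visit_rule_def)
  then show "x \<in> r_boundary V r \<psi> \<union> sucs E v"
    using x Q by (cases "v \<in> Q") (auto simp: r_boundary_def sucs_def preds_def)
qed

lemma r_sequence_snoc:
  assumes "r_sequence V r \<psi>" and "v \<in> V - set \<psi>" and "Q \<in> r v" and "Q \<subseteq> set \<psi>"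
  shows "r_sequence V r (\<psi> @ [v])"
  using assms unfolding r_sequence_def by (auto simp: nth_append less_Suc_eq)

text \<open>An \<open>E\<close>-minimal unvisited vertex has all its predecessors visited, so each
  of its enablers is satisfied; a non-empty one would put it in the boundary.\<close>

lemma empty_enabler_of_empty_boundary:
  assumes "finite_dag V E" and "visit_rule V E r" and "set \<psi> \<subset> V" and "r_boundary V r \<psi> = {}"
  obtains v where "v \<in> V - set \<psi>" and "{} \<in> r v"
proof -
  have "wf E"
    using assms(1) by (metis finite_SigmaI finite_acyclic_wf finite_dag_def finite_subset)
  moreover obtain x where "x \<in> V - set \<psi>" using assms(3) by blast
  ultimately obtain v where v: "v \<in> V - set \<psi>" "\<And>y. (y, v) \<in> E \<Longrightarrow> y \<notin> V - set \<psi>"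
    by (metis wfE_min)
  obtain Q where Q: "Q \<in> r v" "Q \<subseteq> preds E v"
    using assms(2) v(1) unfolding visit_rule_def by blast
  then have "Q \<subseteq> set \<psi>" using v(2) assms(1) by (auto simp: preds_def finite_dag_def)
  then have "Q = {}" using v(1) Q(1) assms(4) by (auto simp: r_boundary_def)
  then show thesis using v(1) Q(1) that by blast
qed

lemma covered_r_sequence_extend:
  assumes "finite_dag V E" and "visit_rule V E r"
    and "r_sequence V r \<psi>" and "covers_boundary V E r \<psi> p" and "set \<psi> \<noteq> V"
  obtains v q where "v \<in> V - set \<psi>" and "r_sequence V r (\<psi> @ [v])"
    and "covers_boundary V E r (\<psi> @ [v]) q"
proof -
  have sub: "set \<psi> \<subseteq> V" using assms(3) by (simp add: r_sequence_def)
  show thesis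
  proof (cases "r_boundary V r \<psi> = {}")
    case True
    with assms sub obtain v where v: "v \<in> V - set \<psi>" "{} \<in> r v"
      using empty_enabler_of_empty_boundary by (metis psubsetI)
    have "covers_boundary V E r (\<psi> @ [v]) [v]"
      using r_boundary_snoc_subset[OF assms(2), of \<psi> v] True by (simp add: covers_boundary_def)
    then show thesis using r_sequence_snoc[OF assms(3) v] v(1) that by blast
  next
    case False
    with assms(4) sub obtain q v where q: "covers_boundary V E r \<psi> q"
      and v: "v \<in> r_boundary V r \<psi>" and path: "directed_path V E (q @ [v])"
      using covers_boundary_cut by metis
    have "covers_boundary V E r (\<psi> @ [v]) (q @ [v])"
      using r_boundary_snoc_subset[OF assms(2), of \<psi> v] q path
      unfolding covers_boundary_def directed_path_def by auto
    moreover obtain Q where "v \<in> V - set \<psi>" "Q \<in> r v" "Q \<subseteq> set \<psi>"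
      using v by (auto simp: r_boundary_def)
    ultimately show thesis using r_sequence_snoc[OF assms(3)] that by blast
  qed
qed

text \<open>Induction on the number of unvisited vertices. The invariant is carried for all prefixes
  because \<open>max_boundary\<close> ranges over them; each prefix has its own path, since
  backtracking replaces it.\<close>

lemma covered_r_visit_exists:
  assumes "finite_dag V E" and "visit_rule V E r"
    and "r_sequence V r \<psi>" and "\<forall>i\<le>length \<psi>. \<exists>p. covers_boundary V E r (take i \<psi>) p"
  shows "\<exists>\<phi>. r_visit V r \<phi> \<and> (\<forall>i\<le>length \<phi>. \<exists>p. covers_boundary V E r (take i \<phi>) p)"
  using assms(3,4)
proof (induction "card (V - set \<psi>)" arbitrary: \<psi> rule: less_induct)
  case less
  show ?case
  proof (cases "set \<psi> = V")
    case True
    then show ?thesis using less.prems by (auto simp: r_visit_def)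
  next
    case False
    obtain p where "covers_boundary V E r \<psi> p" using less.prems(2) by force
    then obtain v q where v: "v \<in> V - set \<psi>" and seq: "r_sequence V r (\<psi> @ [v])"
      and q: "covers_boundary V E r (\<psi> @ [v]) q"
      using covered_r_sequence_extend[OF assms(1,2) less.prems(1)] False by metis
    have "card (V - set (\<psi> @ [v])) < card (V - set \<psi>)"
      using v assms(1) by (intro psubset_card_mono) (auto simp: finite_dag_def)
    moreover have "\<forall>i\<le>length (\<psi> @ [v]). \<exists>p. covers_boundary V E r (take i (\<psi> @ [v])) p"
      using less.prems(2) q by (auto simp: le_Suc_eq)
    ultimately show ?thesis using less.hyps seq by blast
  qed
qed

theorem theorem13:
  fixes V :: "'v set" and E :: "('v \<times> 'v) set" and r :: "'v \<Rightarrow> 'v set set"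
  assumes "finite_dag V E"
    and "visit_rule V E r"
  shows "\<exists>\<psi>. r_visit V r \<psi> \<and>
    int (max_boundary V r \<psi>) \<le> (int (max_out_degree V E) - 1) * int (topological_depth V E) + 1"
proof -
  let ?b = "(max_out_degree V E - 1) * topological_depth V E + 1"
  have "r_sequence V r []" by (simp add: r_sequence_def)
  moreover have "covers_boundary V E r [] []"
    by (auto simp: covers_boundary_def r_boundary_def)
  ultimately obtain \<psi> where \<psi>: "r_visit V r \<psi>"
    and cov: "\<forall>i\<le>length \<psi>. \<exists>p. covers_boundary V E r (take i \<psi>) p"
    using covered_r_visit_exists[OF assms, of "[]"] by auto
  have "card (r_boundary V r (take i \<psi>)) \<le> ?b" if "i \<le> length \<psi>" for i
  proof -
    have "set (take i \<psi>) \<subseteq> V" using \<psi> set_take_subset[of i \<psi>] by (auto simp: r_visit_def)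
    then show ?thesis using cov that card_r_boundary_le[OF assms(1)] by blast
  qed
  then have "max_boundary V r \<psi> \<le> ?b" unfolding max_boundary_def by auto
  \<comment> \<open>Truncated and integer subtraction differ only at out-degree 0. Then there are no
    edges, the depth is 0, and both sides equal 1.\<close>
  moreover have "int ?b = (int (max_out_degree V E) - 1) * int (topological_depth V E) + 1"
  proof (cases "E = {}")
    case True
    then show ?thesis by (simp add: topological_depth_no_edges)
  next
    case False
    then show ?thesis using max_out_degree_pos[OF assms(1)] by (simp add: of_nat_diff)
  qed
  ultimately show ?thesis using \<psi> by (metis of_nat_le_iff)
qed

end
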